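(* Let $Y,Y_1,Y_2,\ldots$ be i.i.d. real random variables with $\mathbb{E}e^{Y}=1$, let $\{W_n\}$ be the CUSUM process generated by $Y_1,Y_2,\ldots$, and let $I$ be the Legendre–Fenchel (Cramér) transform of the distribution of $Y$. Assume that $\mathbb{E}e^{\lambda Y}<\infty$ for all $\lambda$ in some neighbourhood of zero (Cramér's condition) and that $\mathbb{P}(Y>0)>0$. Then $$\liminf_{n\to\infty}\frac{\mathbb{E}e^{W_n}}{n^{\gamma}}=\infty$$ for any $\gamma<\sup_{u>0}\{u/I(u)\}$.
   Context: The CUSUM process based on $Y_1,Y_2,\ldots$ is defined by $W_0=0$ and $W_{n+1}=\max\{W_n+Y_{n+1},0\}$. The Legendre–Fenchel transform is $I(x)=\sup_{\lambda\in\mathbb{R}}\{\lambda x-\log\mathbb{E}e^{\lambda Y}\}\in[0,\infty]$, where $\mathbb{E}e^{\lambda Y}$ may be infinite for some $\lambda$ (such $\lambda$ contribute $-\infty$ to the supremum), and $u/I(u)=0$ if $I(u)=\infty$. *)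

theory Defs
  imports "HOL-Probability.Probability"
begin

text \<open>The CUSUM process driven by \<open>Y 1, Y 2, \<dots>\<close>; the entry \<open>Y 0\<close> is never used.\<close>

primrec cusum :: "(nat \<Rightarrow> 'a \<Rightarrow> real) \<Rightarrow> nat \<Rightarrow> 'a \<Rightarrow> real" where
  "cusum Y 0 = (\<lambda>\<omega>. 0)"
| "cusum Y (Suc n) = (\<lambda>\<omega>. max (cusum Y n \<omega> + Y (Suc n) \<omega>) 0)"

text \<open>For a random variable \<open>X\<close> on a probability space, \<open>exp (l * X)\<close> is positive and
  measurable, so it fails to be integrable exactly when its expectation is infinite.\<close>

definition log_mgf :: "'a measure \<Rightarrow> ('a \<Rightarrow> real) \<Rightarrow> real \<Rightarrow> ereal" where
  "log_mgf M X l =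
     (if integrable M (\<lambda>\<omega>. exp (l * X \<omega>))
      then ereal (ln (\<integral>\<omega>. exp (l * X \<omega>) \<partial>M)) else \<infinity>)"

text \<open>If \<open>log_mgf M X l = \<infinity>\<close>, the corresponding term is \<open>ereal (l * x) - \<infinity> = -\<infinity>\<close>.\<close>

definition cramer_transform :: "'a measure \<Rightarrow> ('a \<Rightarrow> real) \<Rightarrow> real \<Rightarrow> ereal" where
  "cramer_transform M X x = (SUP l. ereal (l * x) - log_mgf M X l)"

end

theory Submission
  imports Defs
begin

text \<open>
  Taking \<open>l = 1\<close> in the Cramer transform gives \<open>I u \<ge> u\<close> for \<open>u > 0\<close>, hence \<open>\<gamma> < 1\<close>, and it is
  enough that \<open>\<E> (exp (W n))\<close> grows at least linearly. Put \<open>\<phi> = \<E> (exp (Y / 2))\<close>; since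
  \<open>\<E> (exp Y) = 1\<close> and \<open>Y\<close> is not a.s. \<open>0\<close>, \<open>\<E> ((exp (Y / 2) - 1)\<^sup>2) > 0\<close> gives \<open>\<phi> < 1\<close>.
  With \<open>x = W n + Y (n + 1)\<close>, the pointwise inequality
  \<open>exp (max x 0) - exp x \<ge> exp (max x 0 / 2) - exp (x / 2)\<close> and independence show that
  \<open>\<E> (exp (W n)) - \<E> (exp (W n / 2))\<close> increases by at least \<open>1 - \<phi>\<close> in each step.
\<close>

lemma cusum_nonneg: "0 \<le> cusum Y n \<omega>"
  by (cases n) auto

text \<open>Lets \<open>cusum Y n\<close> be written as a measurable function on the product space
  over \<open>{1..n}\<close>, the form in which independence of blocks of coordinates
  applies.\<close>

lemma cusum_restrict:
  assumes "{1..n} \<subseteq> J"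
  shows "cusum (\<lambda>i f. f i) n (restrict (\<lambda>i. Y i \<omega>) J) = cusum Y n \<omega>"
  using assms
proof (induction n)
  case (Suc n)
  then have "{1..n} \<subseteq> J" "Suc n \<in> J"
    by auto
  with Suc.IH show ?case
    by simp
qed simp

lemma measurable_cusum:
  assumes "\<And>i. i \<in> {1..n} \<Longrightarrow> Y i \<in> borel_measurable M"
  shows "cusum Y n \<in> borel_measurable M"
  using assms by (induction n) (auto intro!: borel_measurable_max borel_measurable_add)

text \<open>Both sides vanish for \<open>x \<ge> 0\<close>. For \<open>x < 0\<close> the claim reads
  \<open>1 - exp (x / 2) \<le> 1 - exp x\<close>, which holds because
  \<open>x \<le> x / 2\<close>.\<close>

lemma exp_half_gap_le: "exp (max x 0 / 2) - exp (x / 2) \<le> exp (max x 0) - exp (x::real)"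
  by (cases "x \<ge> 0") (auto simp: max_def)

context prob_space
begin

text \<open>The two variables are functions of the disjoint blocks \<open>{1..n}\<close> and
  \<open>{Suc n}\<close> of an independent family.\<close>

lemma indep_var_cusum_Suc:
  assumes "indep_vars (\<lambda>_. borel) Y {1..}"
  shows "indep_var borel (cusum Y n) borel (Y (Suc n))"
proof -
  have "indep_var
      (PiM {1..n} (\<lambda>_. borel)) (\<lambda>\<omega>. restrict (\<lambda>i. Y i \<omega>) {1..n})
      (PiM {Suc n} (\<lambda>_. borel)) (\<lambda>\<omega>. restrict (\<lambda>i. Y i \<omega>) {Suc n})"
    by (rule indep_var_restrict[OF assms]) auto
  moreover have "cusum (\<lambda>i f. f i) n \<in> borel_measurable (PiM {1..n} (\<lambda>_. borel :: real measure))"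
    by (rule measurable_cusum) auto
  moreover have "(\<lambda>f. f (Suc n)) \<in> borel_measurable (PiM {Suc n} (\<lambda>_. borel :: real measure))"
    by auto
  ultimately have "indep_var
      borel (cusum (\<lambda>i f. f i) n \<circ> (\<lambda>\<omega>. restrict (\<lambda>i. Y i \<omega>) {1..n}))
      borel ((\<lambda>f. f (Suc n)) \<circ> (\<lambda>\<omega>. restrict (\<lambda>i. Y i \<omega>) {Suc n}))"
    by (rule indep_var_compose)
  then show ?thesis
    by (simp add: comp_def cusum_restrict)
qed

lemma expectation_exp_add_indep:
  fixes X Z :: "'a \<Rightarrow> real"
  assumes indep: "indep_var borel X borel Z"
    and X: "integrable M (\<lambda>\<omega>. exp (X \<omega>))" and Z: "integrable M (\<lambda>\<omega>. exp (Z \<omega>))"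
  shows "integrable M (\<lambda>\<omega>. exp (X \<omega> + Z \<omega>))"
    and "expectation (\<lambda>\<omega>. exp (X \<omega> + Z \<omega>))
      = expectation (\<lambda>\<omega>. exp (X \<omega>)) * expectation (\<lambda>\<omega>. exp (Z \<omega>))"
proof -
  have "indep_var borel (exp \<circ> X) borel (exp \<circ> Z)"
    by (rule indep_var_compose[OF indep]) auto
  then have ind: "indep_var borel (\<lambda>\<omega>. exp (X \<omega>)) borel (\<lambda>\<omega>. exp (Z \<omega>))"
    by (simp add: comp_def)
  show "integrable M (\<lambda>\<omega>. exp (X \<omega> + Z \<omega>))"
    using indep_var_integrable[OF ind X Z] by (simp add: exp_add)
  show "expectation (\<lambda>\<omega>. exp (X \<omega> + Z \<omega>))
      = expectation (\<lambda>\<omega>. exp (X \<omega>)) * expectation (\<lambda>\<omega>. exp (Z \<omega>))"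
    using indep_var_lebesgue_integral[OF ind X Z] by (simp add: exp_add)
qed

lemma integrable_exp_half:
  fixes X :: "'a \<Rightarrow> real"
  assumes [measurable]: "X \<in> borel_measurable M" and "integrable M (\<lambda>\<omega>. exp (X \<omega>))"
  shows "integrable M (\<lambda>\<omega>. exp (X \<omega> / 2))"
proof (rule Bochner_Integration.integrable_bound)
  show "integrable M (\<lambda>\<omega>. 1 + exp (X \<omega>))"
    using assms(2) by simp
  show "AE \<omega> in M. norm (exp (X \<omega> / 2)) \<le> norm (1 + exp (X \<omega>))"
  proof (rule AE_I2)
    fix \<omega>
    have "exp (X \<omega> / 2) \<le> max 1 (exp (X \<omega>))"
      by (cases "X \<omega> \<ge> 0") (auto simp: max_def)
    also have "\<dots> \<le> 1 + exp (X \<omega>)"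
      by simp
    finally show "norm (exp (X \<omega> / 2)) \<le> norm (1 + exp (X \<omega>))"
      by simp
  qed
qed measurable

lemma expectation_exp_half_less_1:
  fixes X :: "'a \<Rightarrow> real"
  assumes [measurable]: "X \<in> borel_measurable M"
    and E: "expectation (\<lambda>\<omega>. exp (X \<omega>)) = 1"
    and pos: "prob {\<omega> \<in> space M. X \<omega> > 0} > 0"
  shows "expectation (\<lambda>\<omega>. exp (X \<omega> / 2)) < 1"
proof -
  \<comment> \<open>The Bochner integral of a non-integrable function is 0 by convention, so the
    value 1 forces integrability.\<close>
  have int: "integrable M (\<lambda>\<omega>. exp (X \<omega>))"
    using E not_integrable_integral_eq by fastforce
  note int2 = integrable_exp_half[OF assms(1) int]
  have sq: "(exp (X \<omega> / 2) - 1)\<^sup>2 = exp (X \<omega>) - 2 * exp (X \<omega> / 2) + 1" for \<omega>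
    by (simp add: power2_diff flip: exp_double)
  have int_sq: "integrable M (\<lambda>\<omega>. (exp (X \<omega> / 2) - 1)\<^sup>2)"
    unfolding sq using int int2 by simp
  \<comment> \<open>By \<open>E\<close> the right-hand side is twice the gap between 1 and the
    expectation of \<open>exp (X / 2)\<close>, so it remains to see that the square has positive
    mean.\<close>
  have "expectation (\<lambda>\<omega>. (exp (X \<omega> / 2) - 1)\<^sup>2)
      = expectation (\<lambda>\<omega>. exp (X \<omega>)) - 2 * expectation (\<lambda>\<omega>. exp (X \<omega> / 2)) + 1"
    unfolding sq using int int2 by (simp add: prob_space)
  moreover have "expectation (\<lambda>\<omega>. (exp (X \<omega> / 2) - 1)\<^sup>2) \<noteq> 0"
  proof
    assume "expectation (\<lambda>\<omega>. (exp (X \<omega> / 2) - 1)\<^sup>2) = 0"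
    then have "AE \<omega> in M. (exp (X \<omega> / 2) - 1)\<^sup>2 = 0"
      using integral_nonneg_eq_0_iff_AE[OF int_sq] by simp
    \<comment> \<open>A vanishing square means \<open>exp (X \<omega> / 2) = 1\<close>, that is
      \<open>X \<omega> = 0\<close>.\<close>
    then have "AE \<omega> in M. \<not> X \<omega> > 0"
      by eventually_elim simp
    then have "prob {\<omega> \<in> space M. X \<omega> > 0} = 0"
      by (subst prob_eq_0) auto
    with pos show False by simp
  qed
  moreover have "expectation (\<lambda>\<omega>. (exp (X \<omega> / 2) - 1)\<^sup>2) \<ge> 0"
    by simp
  ultimately show ?thesis
    using E by linarith
qed

lemma expectation_exp_cusum_ge:
  assumes indep: "indep_vars (\<lambda>_. borel) Y {1..}"
    and E: "\<And>n. n \<ge> 1 \<Longrightarrow> expectation (\<lambda>\<omega>. exp (Y n \<omega>)) = 1"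
    and E2: "\<And>n. n \<ge> 1 \<Longrightarrow> expectation (\<lambda>\<omega>. exp (Y n \<omega> / 2)) = \<phi>"
    and "\<phi> \<le> 1"
  shows "expectation (\<lambda>\<omega>. exp (cusum Y n \<omega>)) \<ge> (1 - \<phi>) * real n"
proof -
  have Y: "Y i \<in> borel_measurable M" if "i \<ge> 1" for i
    using indep that by (auto simp: indep_vars_def2)
  have W: "cusum Y n \<in> borel_measurable M" for n
    by (rule measurable_cusum) (auto intro: Y)
  have intY: "integrable M (\<lambda>\<omega>. exp (Y i \<omega>))" if "i \<ge> 1" for i
    using E[OF that] not_integrable_integral_eq by fastforce
  \<comment> \<open>The induction runs on the difference of the two exponential moments, which is 0
    at \<open>n = 0\<close>. Integrability is carried along because the product formula for the next
    step requires it.\<close>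
  have "integrable M (\<lambda>\<omega>. exp (cusum Y n \<omega>)) \<and>
     expectation (\<lambda>\<omega>. exp (cusum Y n \<omega>)) - expectation (\<lambda>\<omega>. exp (cusum Y n \<omega> / 2))
       \<ge> (1 - \<phi>) * real n"
  proof (induction n)
    case 0
    then show ?case by simp
  next
    case (Suc n)
    define X where "X = (\<lambda>\<omega>. cusum Y n \<omega> + Y (Suc n) \<omega>)"
    define V where "V = cusum Y (Suc n)"
    have V_eq: "V = (\<lambda>\<omega>. max (X \<omega>) 0)"
      by (simp add: V_def X_def)
    have [measurable]: "X \<in> borel_measurable M" "V \<in> borel_measurable M"
      unfolding X_def V_def using W Y by (auto simp del: cusum.simps)
    have intW: "integrable M (\<lambda>\<omega>. exp (cusum Y n \<omega>))"
      using Suc.IH by blast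
    have indep1: "indep_var borel (cusum Y n) borel (Y (Suc n))"
      by (rule indep_var_cusum_Suc[OF indep])
    have "indep_var borel ((\<lambda>x. x / 2) \<circ> cusum Y n) borel ((\<lambda>x. x / 2) \<circ> Y (Suc n))"
      by (rule indep_var_compose[OF indep1]) auto
    then have indep2: "indep_var borel (\<lambda>\<omega>. cusum Y n \<omega> / 2) borel (\<lambda>\<omega>. Y (Suc n) \<omega> / 2)"
      by (simp add: comp_def)
    have intX: "integrable M (\<lambda>\<omega>. exp (X \<omega>))"
      and EX: "expectation (\<lambda>\<omega>. exp (X \<omega>)) = expectation (\<lambda>\<omega>. exp (cusum Y n \<omega>))"
      using expectation_exp_add_indep[OF indep1 intW intY] E[of "Suc n"] by (auto simp: X_def)
    have intX2: "integrable M (\<lambda>\<omega>. exp (X \<omega> / 2))"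
      and EX2: "expectation (\<lambda>\<omega>. exp (X \<omega> / 2)) = expectation (\<lambda>\<omega>. exp (cusum Y n \<omega> / 2)) * \<phi>"
      using expectation_exp_add_indep[OF indep2 integrable_exp_half[OF W intW]
          integrable_exp_half[OF Y intY]] E2[of "Suc n"]
      by (auto simp: X_def add_divide_distrib)
    have intV: "integrable M (\<lambda>\<omega>. exp (V \<omega>))"
    proof (rule Bochner_Integration.integrable_bound)
      show "integrable M (\<lambda>\<omega>. 1 + exp (X \<omega>))"
        using intX by simp
    \<comment> \<open>Domination by \<open>exp (max x 0) \<le> 1 + exp x\<close>.\<close>
    qed (auto simp: V_eq max_def)
    have intV2: "integrable M (\<lambda>\<omega>. exp (V \<omega> / 2))"
      by (rule integrable_exp_half) (use intV in auto)
    have "expectation (\<lambda>\<omega>. exp (V \<omega> / 2) - exp (X \<omega> / 2)) \<le> expectation (\<lambda>\<omega>. exp (V \<omega>) - exp (X \<omega>))"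
      by (rule integral_mono)
        (use intV intV2 intX intX2 exp_half_gap_le in \<open>auto simp: V_eq\<close>)
    \<comment> \<open>Adding \<open>Y (Suc n)\<close> preserves the full exponential moment, since
      its factor is 1, but multiplies the half-exponent moment by \<open>\<phi>\<close>.\<close>
    then have step: "expectation (\<lambda>\<omega>. exp (V \<omega>)) - expectation (\<lambda>\<omega>. exp (V \<omega> / 2))
        \<ge> expectation (\<lambda>\<omega>. exp (cusum Y n \<omega>)) - expectation (\<lambda>\<omega>. exp (cusum Y n \<omega> / 2)) * \<phi>"
      using intV intV2 intX intX2 by (simp add: EX EX2)
    \<comment> \<open>Write \<open>a\<close> and \<open>b\<close> for the moments of
      \<open>cusum Y n\<close> with full and half exponent. Then
      \<open>a - b * \<phi> = (a - b) + (1 - \<phi>) * b\<close>, and \<open>b \<ge> 1\<close> turns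
      the last term into the required gain \<open>1 - \<phi>\<close>.\<close>
    have "expectation (\<lambda>\<omega>. exp (cusum Y n \<omega> / 2)) \<ge> 1"
      by (rule integral_ge_const[OF integrable_exp_half[OF W intW]]) (simp add: cusum_nonneg)
    then have "(1 - \<phi>) * 1 \<le> (1 - \<phi>) * expectation (\<lambda>\<omega>. exp (cusum Y n \<omega> / 2))"
      by (rule mult_left_mono) (use \<open>\<phi> \<le> 1\<close> in simp)
    with step Suc.IH have "expectation (\<lambda>\<omega>. exp (V \<omega>)) - expectation (\<lambda>\<omega>. exp (V \<omega> / 2))
        \<ge> (1 - \<phi>) * real (Suc n)"
      by (simp add: algebra_simps)
    with intV show ?case
      unfolding V_def by blast
  qed
  moreover have "expectation (\<lambda>\<omega>. exp (cusum Y n \<omega> / 2)) \<ge> 0"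
    by simp
  ultimately show ?thesis
    by linarith
qed

end

lemma cramer_transform_ge:
  assumes "(\<integral>\<omega>. exp (X \<omega>) \<partial>M) = 1"
  shows "ereal u \<le> cramer_transform M X u"
proof -
  have "integrable M (\<lambda>\<omega>. exp (X \<omega>))"
    using assms not_integrable_integral_eq by fastforce
  \<comment> \<open>Here \<open>log_mgf M X 1 = ln 1 = 0\<close>.\<close>
  then have "ereal u = ereal (1 * u) - log_mgf M X 1"
    using assms by (simp add: log_mgf_def)
  also have "\<dots> \<le> cramer_transform M X u"
    unfolding cramer_transform_def by (rule SUP_upper) simp
  finally show ?thesis .
qed

lemma SUP_div_cramer_transform_le_1:
  assumes "(\<integral>\<omega>. exp (X \<omega>) \<partial>M) = 1"
  shows "(SUP u\<in>{0<..}. ereal u / cramer_transform M X u) \<le> 1"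
proof (rule SUP_least)
  fix u :: real
  assume "u \<in> {0<..}"
  then show "ereal u / cramer_transform M X u \<le> 1"
    using cramer_transform_ge[OF assms, of u]
    \<comment> \<open>A real value of the transform is at least \<open>u > 0\<close>, the value
      \<open>\<infinity>\<close> makes the quotient 0, and \<open>-\<infinity>\<close> contradicts
      the lower bound.\<close>
    by (cases "cramer_transform M X u") auto
qed

theorem theorem4p2:
  fixes M :: "'a measure" and Y :: "'a \<Rightarrow> real" and Ys :: "nat \<Rightarrow> 'a \<Rightarrow> real"
    and \<gamma> :: real
  assumes "prob_space M"
    and "Y \<in> borel_measurable M"
    and "prob_space.indep_vars M (\<lambda>_. borel) Ys {1..}"
    and "\<And>n. n \<ge> 1 \<Longrightarrow> distr M borel (Ys n) = distr M borel Y"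
    and "(\<integral>\<omega>. exp (Y \<omega>) \<partial>M) = 1"
    and "\<exists>\<epsilon>>0. \<forall>l::real. \<bar>l\<bar> < \<epsilon> \<longrightarrow> integrable M (\<lambda>\<omega>. exp (l * Y \<omega>))"
    and "measure M {\<omega> \<in> space M. Y \<omega> > 0} > 0"
    and "ereal \<gamma> < (SUP u\<in>{0<..}. ereal u / cramer_transform M Y u)"
  shows "liminf (\<lambda>n. ereal ((\<integral>\<omega>. exp (cusum Ys n \<omega>) \<partial>M) / real n powr \<gamma>)) = \<infinity>"
proof -
  interpret prob_space M by fact
  define \<phi> where "\<phi> = expectation (\<lambda>\<omega>. exp (Y \<omega> / 2))"
  have "\<phi> < 1"
    unfolding \<phi>_def using assms by (intro expectation_exp_half_less_1)
  have "\<gamma> < 1"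
    using less_le_trans[OF assms(8) SUP_div_cramer_transform_le_1[OF assms(5)]] by simp
  have expectation_eq: "expectation (\<lambda>\<omega>. f (Ys n \<omega>)) = expectation (\<lambda>\<omega>. f (Y \<omega>))"
    if "n \<ge> 1" and [measurable]: "f \<in> borel_measurable borel" for n and f :: "real \<Rightarrow> real"
  proof -
    have [measurable]: "Ys n \<in> borel_measurable M"
      using assms(3) \<open>n \<ge> 1\<close> by (auto simp: indep_vars_def2)
    have "expectation (\<lambda>\<omega>. f (Ys n \<omega>)) = (\<integral>x. f x \<partial>distr M borel (Ys n))"
      by (subst integral_distr) auto
    also have "\<dots> = expectation (\<lambda>\<omega>. f (Y \<omega>))"
      using assms(2) by (simp add: assms(4)[OF \<open>n \<ge> 1\<close>] integral_distr)
    finally show ?thesis .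
  qed
  have lower: "(1 - \<phi>) * real n \<le> expectation (\<lambda>\<omega>. exp (cusum Ys n \<omega>))" for n
    using assms(3,5) \<open>\<phi> < 1\<close>
    by (intro expectation_exp_cusum_ge) (simp_all add: expectation_eq[of _ exp]
        expectation_eq[of _ "\<lambda>x. exp (x / 2)"] \<phi>_def)
  \<comment> \<open>This is the linear bound \<open>lower\<close> divided by
    \<open>n powr \<gamma>\<close>; it diverges because \<open>1 - \<phi>\<close> and
    \<open>1 - \<gamma>\<close> are both positive.\<close>
  have "filterlim (\<lambda>n. (1 - \<phi>) * real n powr (1 - \<gamma>)) at_top sequentially"
    using \<open>\<phi> < 1\<close> \<open>\<gamma> < 1\<close>
    by (intro filterlim_tendsto_pos_mult_at_top[OF tendsto_const]
        filterlim_compose[OF real_powr_at_top filterlim_real_sequentially]) auto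
  moreover have "\<forall>\<^sub>F n in sequentially. (1 - \<phi>) * real n powr (1 - \<gamma>)
      \<le> expectation (\<lambda>\<omega>. exp (cusum Ys n \<omega>)) / real n powr \<gamma>"
    using eventually_gt_at_top[of 0]
  proof eventually_elim
    case (elim n)
    then show ?case
      using divide_right_mono[OF lower, of "real n powr \<gamma>" n] by (simp add: powr_diff)
  qed
  ultimately have "filterlim (\<lambda>n. expectation (\<lambda>\<omega>. exp (cusum Ys n \<omega>)) / real n powr \<gamma>)
      at_top sequentially"
    by (rule filterlim_at_top_mono)
  \<comment> \<open>The sequence even has limit \<open>\<infinity>\<close>, so its
    \<open>liminf\<close> takes the same value.\<close>
  then show ?thesis
    by (intro lim_imp_Liminf) (simp_all add: tendsto_PInfty_eq_at_top)
qed

end
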